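(* Let $G$ be a finite simple graph on vertex set $\{1,\dots,n\}$, $n\ge1$, with adjacency matrix $A^G$, and let $\alpha(G)$ be the maximum cardinality of a stable (independent) set of $G$. Then $$\frac1{\alpha(G)}=\min\Big\{x^\top\big(A^G+I_n\big)x:\ \sum_{i=1}^n x_i=1,\ x\in\mathbb{R}^n,\ x\ge 0\Big\}.$$
   Context: $I_n$ is the $n\times n$ identity matrix; $x\ge0$ is meant componentwise. *)

theory Defs
  imports
    "Graph_Theory.Pair_Digraph"
    "Jordan_Normal_Form.Matrix"
begin

text \<open>
  A finite simple graph is a \<open>pair_graph\<close>: a finite digraph without loops and parallel
  arcs whose arc relation is symmetric, an edge \<open>uv\<close> being the two arcs \<open>(u, v)\<close>
  and \<open>(v, u)\<close>.
\<close>

definition stable_set :: "'a pair_pre_digraph \<Rightarrow> 'a set \<Rightarrow> bool" where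
  "stable_set G S \<longleftrightarrow> S \<subseteq> pverts G \<and> (\<forall>u\<in>S. \<forall>v\<in>S. (u, v) \<notin> parcs G)"

definition stability_number :: "'a pair_pre_digraph \<Rightarrow> nat" where
  "stability_number G = Max {card S | S. stable_set G S}"

text \<open>
  Matrix indices start at \<open>0\<close>, so for vertex set \<open>{1..n}\<close> index \<open>i < n\<close> stands for
  vertex \<open>Suc i\<close>.
\<close>

definition adjacency_mat :: "nat \<Rightarrow> nat pair_pre_digraph \<Rightarrow> real mat" where
  "adjacency_mat n G = mat n n (\<lambda>(i, j). if (Suc i, Suc j) \<in> parcs G then 1 else 0)"

text \<open>\<open>Min\<close> is only meaningful for finite sets; the following allows infinite ones.\<close>

definition is_minimum :: "'a::order \<Rightarrow> 'a set \<Rightarrow> bool" where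
  "is_minimum m A \<longleftrightarrow> m \<in> A \<and> (\<forall>a\<in>A. m \<le> a)"

end

theory Submission
  imports Defs
begin

text \<open>
  Put \<open>M = A + I\<close> and \<open>s = M x\<close>. Greedily picking a vertex \<open>v\<close> with \<open>s v\<close> minimal and deleting
  its closed neighbourhood gives a stable set \<open>T\<close> with \<open>(\<Sum>i. x i / s i) \<le> card T\<close>, because each
  deleted neighbourhood contributes at most \<open>(\<Sum>i\<in>N[v]. x i) / s v \<le> 1\<close>. As \<open>\<Sum>i. x i = 1\<close>,
  the Cauchy--Schwarz inequality \<open>1 \<le> (\<Sum>i. x i * s i) * (\<Sum>i. x i / s i)\<close> yields the lower
  bound; it is used below in the form \<open>2 * k * x i \<le> x i / s i + k\<^sup>2 * x i * s i\<close>
  with \<open>k = \<alpha>(G)\<close>, summed over \<open>i\<close>. The uniform distribution on a maximum stable set attains it.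
\<close>

text \<open>\<open>s\<close> is only required to dominate the neighbourhood sums, so that the
  induction can keep it fixed: deleting vertices shrinks these sums because \<open>x\<close> is
  nonnegative. \<open>R\<close> is adjacency made reflexive, hence
  \<open>{j \<in> S. (i, j) \<in> R}\<close> is a closed neighbourhood.\<close>

lemma greedy_independent_set:
  fixes x s :: "'a \<Rightarrow> real"
  assumes "finite S" "\<And>i. i \<in> S \<Longrightarrow> 0 \<le> x i" "sym R"
    "\<And>i. i \<in> S \<Longrightarrow> (i, i) \<in> R"
    "\<And>i. i \<in> S \<Longrightarrow> sum x {j \<in> S. (i, j) \<in> R} \<le> s i"
  shows "\<exists>T\<subseteq>S. (\<forall>u\<in>T. \<forall>v\<in>T. (u, v) \<in> R \<longrightarrow> u = v) \<and> (\<Sum>i\<in>S. x i / s i) \<le> real (card T)"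
  using assms
proof (induction S rule: finite_psubset_induct)
  case (psubset S)
  show ?case
  proof (cases "S = {}")
    case False
    obtain v where v: "v \<in> S" "\<And>i. i \<in> S \<Longrightarrow> s v \<le> s i"
      using arg_min_if_finite[OF \<open>finite S\<close> False, of s] by (metis not_le)
    define N where "N = {j \<in> S. (v, j) \<in> R}"
    have N: "N \<subseteq> S" "v \<in> N" "finite N" using v psubset.prems psubset.hyps by (auto simp: N_def)
    have sN: "sum x N \<le> s v" using psubset.prems(4)[OF v(1)] by (simp add: N_def)
    have IH: "\<exists>T\<subseteq>S - N. (\<forall>u\<in>T. \<forall>v\<in>T. (u, v) \<in> R \<longrightarrow> u = v)
        \<and> (\<Sum>i\<in>S - N. x i / s i) \<le> real (card T)"
    proof (rule psubset.IH)
      show "S - N \<subset> S" using N by auto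
      show "sum x {j \<in> S - N. (i, j) \<in> R} \<le> s i" if "i \<in> S - N" for i
        using that psubset.prems(1) psubset.hyps
        by (intro order.trans[OF sum_mono2 psubset.prems(4)[of i]]) auto
    qed (use psubset.prems in auto)
    then obtain T where T: "T \<subseteq> S - N" "\<forall>u\<in>T. \<forall>v\<in>T. (u, v) \<in> R \<longrightarrow> u = v"
      "(\<Sum>i\<in>S - N. x i / s i) \<le> real (card T)" by blast
    have "0 \<le> sum x N" using N psubset.prems(1) by (intro sum_nonneg) auto
    hence sv: "0 \<le> s v" using sN by simp
    have "(\<Sum>i\<in>N. x i / s i) \<le> 1"
    \<comment> \<open>If \<open>s v = 0\<close>, then \<open>x\<close> vanishes on all of
      \<open>N\<close>, and so does every quotient. Otherwise minimality of \<open>s v\<close>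
      allows each denominator \<open>s i\<close> to be replaced by \<open>s v\<close>.\<close>
    proof (cases "s v = 0")
      case True
      have "sum x N = 0" using True sN \<open>0 \<le> sum x N\<close> by simp
      hence "\<forall>i\<in>N. x i = 0"
        using N psubset.prems(1) by (subst (asm) sum_nonneg_eq_0_iff) auto
      thus ?thesis by simp
    next
      case False
      with sv have pos: "0 < s v" by simp
      have "(\<Sum>i\<in>N. x i / s i) \<le> (\<Sum>i\<in>N. x i / s v)"
        using N v pos psubset.prems(1) by (intro sum_mono divide_left_mono mult_pos_pos) (auto intro: less_le_trans)
      also have "\<dots> = sum x N / s v" by (simp add: sum_divide_distrib)
      also have "\<dots> \<le> 1" using pos sN by simp
      finally show ?thesis .
    qed
    moreover have "(\<Sum>i\<in>S. x i / s i) = (\<Sum>i\<in>S - N. x i / s i) + (\<Sum>i\<in>N. x i / s i)"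
      using N psubset.hyps by (intro sum.subset_diff) auto
    moreover have "card (insert v T) = Suc (card T)"
      using T N psubset.hyps by (subst card_insert_disjoint) (auto intro: finite_subset)
    ultimately have "(\<Sum>i\<in>S. x i / s i) \<le> real (card (insert v T))" using T(3) by simp
    \<comment> \<open>\<open>T\<close> avoids \<open>N\<close>, so \<open>v\<close> is related to no
      member of \<open>T\<close>; symmetry of \<open>R\<close> gives the other direction.\<close>
    moreover have "\<forall>u\<in>insert v T. \<forall>w\<in>insert v T. (u, w) \<in> R \<longrightarrow> u = w"
      using T N \<open>sym R\<close> by (auto simp: N_def dest: symD)
    moreover have "insert v T \<subseteq> S" using T v by auto
    ultimately show ?thesis by blast
  qed simp
qed

text \<open>Here \<open>k\<close> is any upper bound for the sizes of independent sets. The termwise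
  inequality replaces Cauchy--Schwarz and avoids a case distinction for vertices with
  \<open>s i = 0\<close>: there \<open>x i = 0\<close>, and both sides vanish.\<close>

lemma independent_set_quadratic_form_ge:
  fixes x :: "'a \<Rightarrow> real"
  assumes "finite S" "\<And>i. i \<in> S \<Longrightarrow> 0 \<le> x i" "sym R"
    "\<And>i. i \<in> S \<Longrightarrow> (i, i) \<in> R" "sum x S = 1"
    and k: "\<And>T. T \<subseteq> S \<Longrightarrow> \<forall>u\<in>T. \<forall>v\<in>T. (u, v) \<in> R \<longrightarrow> u = v \<Longrightarrow> card T \<le> k"
  shows "1 \<le> real k * (\<Sum>i\<in>S. x i * sum x {j \<in> S. (i, j) \<in> R})"
proof -
  define s where "s i = sum x {j \<in> S. (i, j) \<in> R}" for i
  have "S \<noteq> {}" using assms(5) by auto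
  then obtain i where "i \<in> S" by blast
  with k[of "{i}"] have "1 \<le> k" by simp
  obtain T where T: "T \<subseteq> S" "\<forall>u\<in>T. \<forall>v\<in>T. (u, v) \<in> R \<longrightarrow> u = v"
    "(\<Sum>i\<in>S. x i / s i) \<le> real (card T)"
    using greedy_independent_set[of S x R s] assms(1-4) unfolding s_def by blast
  have "2 * real k * x i \<le> x i / s i + (real k)\<^sup>2 * (x i * s i)" if "i \<in> S" for i
  proof (cases "x i = 0")
    case False
    have "x i \<le> s i"
      unfolding s_def using that assms by (intro member_le_sum) auto
    with False assms(2)[OF that] have pos: "0 < x i" "0 < s i" by auto
    \<comment> \<open>The square vanishes at \<open>s i = 1 / k\<close>, the value of
      \<open>s\<close> on the support of the uniform distribution on an independent set of size
      \<open>k\<close>.\<close>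
    have "0 \<le> x i / s i * (1 - real k * s i)\<^sup>2" using pos by simp
    also have "\<dots> = x i / s i + (real k)\<^sup>2 * (x i * s i) - 2 * real k * x i"
      using pos by (simp add: field_simps power2_eq_square)
    finally show ?thesis by simp
  qed simp
  hence "(\<Sum>i\<in>S. 2 * real k * x i) \<le> (\<Sum>i\<in>S. x i / s i + (real k)\<^sup>2 * (x i * s i))"
    by (rule sum_mono)
  also have "\<dots> \<le> real k + (real k)\<^sup>2 * (\<Sum>i\<in>S. x i * s i)"
    using T(3) k[OF T(1,2)] by (simp add: sum.distrib flip: sum_distrib_left)
  finally have "2 * real k \<le> real k + (real k)\<^sup>2 * (\<Sum>i\<in>S. x i * s i)"
    using assms(5) by (simp flip: sum_distrib_left)
  hence "real k * 1 \<le> real k * (real k * (\<Sum>i\<in>S. x i * s i))"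
    by (simp add: power2_eq_square mult.assoc)
  hence "1 \<le> real k * (\<Sum>i\<in>S. x i * s i)"
    using \<open>1 \<le> k\<close> by (subst (asm) mult_le_cancel_left_pos) auto
  thus ?thesis by (simp add: s_def)
qed

text \<open>Without loops the diagonal of the adjacency matrix is zero, so all entries of the sum
  with the identity are 0 or 1 and each row sums \<open>x\<close> over a closed
  neighbourhood.\<close>

lemma quadratic_form_adjacency:
  assumes "pair_graph G" "x \<in> carrier_vec n"
  shows "x \<bullet> ((adjacency_mat n G + 1\<^sub>m n) *\<^sub>v x) =
    (\<Sum>i<n. x $ i * (\<Sum>j \<in> {j \<in> {..<n}. i = j \<or> (Suc i, Suc j) \<in> parcs G}. x $ j))"
proof -
  interpret pair_graph G by fact
  have loop: "(u, u) \<notin> parcs G" for u using no_loops'[of u u] by auto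
  have row: "((adjacency_mat n G + 1\<^sub>m n) *\<^sub>v x) $ i =
      (\<Sum>j \<in> {j \<in> {..<n}. i = j \<or> (Suc i, Suc j) \<in> parcs G}. x $ j)" if "i < n" for i
  proof -
    have "((adjacency_mat n G + 1\<^sub>m n) *\<^sub>v x) $ i =
        (\<Sum>j<n. (adjacency_mat n G + 1\<^sub>m n) $$ (i, j) * x $ j)"
      using that assms(2) by (simp add: scalar_prod_def adjacency_mat_def lessThan_atLeast0 eq_commute[of _ i])
    also have "\<dots> = (\<Sum>j<n. if i = j \<or> (Suc i, Suc j) \<in> parcs G then x $ j else 0)"
      using that loop by (intro sum.cong refl) (auto simp: adjacency_mat_def)
    finally show ?thesis by (simp only: sum.inter_filter[OF finite_lessThan])
  qed
  have "dim_vec ((adjacency_mat n G + 1\<^sub>m n) *\<^sub>v x) = n" by (simp add: adjacency_mat_def)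
  thus ?thesis unfolding scalar_prod_def using row by (simp add: lessThan_atLeast0)
qed

lemma
  assumes "finite (pverts G)"
  shows stable_set_card_le: "stable_set G S \<Longrightarrow> card S \<le> stability_number G"
    and stability_number_attained: "\<exists>S. stable_set G S \<and> card S = stability_number G"
proof -
  have "finite {S. stable_set G S}"
    using assms by (rule finite_subset[rotated, OF finite_Pow_iff[THEN iffD2]]) (auto simp: stable_set_def)
  hence fin: "finite {card S | S. stable_set G S}" by (rule finite_image_set)
  show "stable_set G S \<Longrightarrow> card S \<le> stability_number G"
    unfolding stability_number_def using fin by (intro Max_ge) auto
  have "stable_set G {}" by (simp add: stable_set_def)
  hence "{card S | S. stable_set G S} \<noteq> {}" by blast
  from Max_in[OF fin this] show "\<exists>S. stable_set G S \<and> card S = stability_number G"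
    unfolding stability_number_def by auto
qed

theorem proposition1:
  fixes n :: nat and G :: "nat pair_pre_digraph"
  assumes "n \<ge> 1" and "pair_graph G" and "pverts G = {1..n}"
  shows "is_minimum (1 / real (stability_number G))
    {x \<bullet> ((adjacency_mat n G + 1\<^sub>m n) *\<^sub>v x) | x.
      x \<in> carrier_vec n \<and> (\<Sum>i<n. x $ i) = 1 \<and> 0\<^sub>v n \<le> x}"
proof -
  interpret pair_graph G by fact
  let ?k = "stability_number G"
  let ?Q = "\<lambda>x. x \<bullet> ((adjacency_mat n G + 1\<^sub>m n) *\<^sub>v x)"
  define R where "R = {(i, j). i = j \<or> (Suc i, Suc j) \<in> parcs G}"
  note Q = quadratic_form_adjacency[OF assms(2)]
  have symm: "(u, v) \<in> parcs G \<Longrightarrow> (v, u) \<in> parcs G" for u v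
    using arcs_symmetric by auto
  have symR: "sym R" unfolding sym_def R_def using symm by auto
  have finV: "finite (pverts G)" using assms(3) by simp
  have loop: "(u, u) \<notin> parcs G" for u using no_loops'[of u u] by auto
  \<comment> \<open>Vertex 1 exists because \<open>n \<ge> 1\<close>; thus \<open>?k\<close> is
    positive and may be divided by.\<close>
  have "stable_set G {1}" using assms loop by (auto simp: stable_set_def)
  from stable_set_card_le[OF finV this] have k: "1 \<le> ?k" by simp

  obtain S where S: "stable_set G S" "card S = ?k"
    using stability_number_attained[OF finV] by blast
  define x where "x = vec n (\<lambda>i. if Suc i \<in> S then 1 / real ?k else 0)"
  have Sn: "S \<subseteq> {1..n}" using S(1) assms(3) by (simp add: stable_set_def)
  \<comment> \<open>Passing from vertices to matrix indices preserves the cardinality, as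
    \<open>Suc\<close> is injective.\<close>
  have "S = Suc ` {i \<in> {..<n}. Suc i \<in> S}"
  proof (intro equalityI subsetI)
    fix v assume v: "v \<in> S"
    with Sn have "v \<in> {1..n}" by blast
    hence "v = Suc (v - 1)" "v - 1 < n" by auto
    with v show "v \<in> Suc ` {i \<in> {..<n}. Suc i \<in> S}" by (intro image_eqI[of _ _ "v - 1"]) auto
  qed auto
  hence "card S = card (Suc ` {i \<in> {..<n}. Suc i \<in> S})" by (rule arg_cong)
  hence card: "card {i \<in> {..<n}. Suc i \<in> S} = ?k"
    using S(2) by (subst (asm) card_image) auto
  have sumS: "(\<Sum>i<n. if Suc i \<in> S then c else 0) = real ?k * c" for c :: real
    by (simp only: sum.inter_filter[OF finite_lessThan, symmetric] sum_constant card)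
  have x: "x \<in> carrier_vec n" "0\<^sub>v n \<le> x" "(\<Sum>i<n. x $ i) = 1"
    using sumS[of "1 / real ?k"] k by (auto simp: x_def less_eq_vec_def)
  \<comment> \<open>A vertex of the stable set \<open>S\<close> has no neighbour in
    \<open>S\<close>, so only the diagonal term survives. Rows outside \<open>S\<close> carry weight
    0 in \<open>?Q x\<close>, which leaves \<open>?k\<close> terms, each the square of
    \<open>1 / ?k\<close>.\<close>
  have inner: "(\<Sum>j \<in> {j \<in> {..<n}. i = j \<or> (Suc i, Suc j) \<in> parcs G}. x $ j) = 1 / real ?k"
    if "i < n" "Suc i \<in> S" for i
  proof -
    have "(\<Sum>j \<in> {j \<in> {..<n}. i = j \<or> (Suc i, Suc j) \<in> parcs G}. x $ j) = (\<Sum>j \<in> {i}. x $ j)"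
      using that S(1) by (intro sum.mono_neutral_right) (auto simp: x_def stable_set_def)
    thus ?thesis using that by (simp add: x_def)
  qed
  have "?Q x = (\<Sum>i<n. if Suc i \<in> S then 1 / real ?k * (1 / real ?k) else 0)"
    unfolding Q[OF x(1)] using inner by (intro sum.cong) (auto simp: x_def)
  also have "\<dots> = 1 / real ?k" using sumS k by simp
  finally have attained: "?Q x = 1 / real ?k" .

  have lower: "1 / real ?k \<le> ?Q y"
    if y: "y \<in> carrier_vec n" "(\<Sum>i<n. y $ i) = 1" "0\<^sub>v n \<le> y" for y
  proof -
    have nonneg: "0 \<le> y $ i" if "i < n" for i
      using y that by (auto simp: less_eq_vec_def)
    have "1 \<le> real ?k * (\<Sum>i<n. y $ i * (\<Sum>j \<in> {j \<in> {..<n}. (i, j) \<in> R}. y $ j))"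
    proof (rule independent_set_quadratic_form_ge)
      fix T assume "T \<subseteq> {..<n}" "\<forall>u\<in>T. \<forall>v\<in>T. (u, v) \<in> R \<longrightarrow> u = v"
      \<comment> \<open>Distinct members of \<open>T\<close> are non-adjacent by the property of
        \<open>R\<close>; equal ones are so because \<open>G\<close> has no loops.\<close>
      hence "stable_set G (Suc ` T)"
        using assms(3) loop by (fastforce simp: stable_set_def R_def)
      from stable_set_card_le[OF finV this] show "card T \<le> ?k" by (simp add: card_image)
    qed (use y nonneg symR in \<open>auto simp: R_def\<close>)
    hence "1 \<le> real ?k * ?Q y" unfolding Q[OF y(1)] by (simp add: R_def)
    thus ?thesis using k by (simp add: field_simps)
  qed
  show ?thesis unfolding is_minimum_def
  proof (intro conjI ballI)
    show "1 / real ?k \<in> {?Q x | x. x \<in> carrier_vec n \<and> (\<Sum>i<n. x $ i) = 1 \<and> 0\<^sub>v n \<le> x}"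
      using x attained[symmetric] by blast
  qed (use lower in blast)
qed

end
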